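(* Let $(\mathcal A,\varphi)$ be a noncommutative probability space and let $\{T_i\}_{i\in\mathbb N},\{T_i^{*}\}_{i\in\mathbb N},\{T_i'\}_{i\in\mathbb N}\subset\mathcal A$ be elements, where $T_i^*$ is the adjoint of $T_i$. For $\epsilon\in\{1,*,\prime\}$ write $T_i^{\epsilon}$ for $T_i$, $T_i^*$, $T_i'$ respectively. Assume the following. (a) (vanishing means and some second mixed moments) For all $i\in\mathbb N$: $\varphi(T_i)=\varphi(T_i^* )=\varphi(T_i')=0$ and $$\varphi(T_i^*T_i^* )=\varphi(T_iT_i)=\varphi(T_iT_i^* )=\varphi(T_iT_i')=\varphi(T_i'T_i')=\varphi(T_i'T_i)=\varphi(T_i'T_i^* )=0.$$ (b) (uniform bounds) For every $n$ and every set partition $\pi$ of $[n]$ there is a real $\varrho_\pi\ge 0$ such that for all $\underline i\in\mathbb N^n$ with $\ker\underline i=\pi$ and all $\epsilon\in\{1,*,\prime\}^n$, $$\Big|\varphi\Big(T_{i(1)}^{\epsilon(1)}\cdots T_{i(n)}^{\epsilon(n)}\Big)\Big|\le\varrho_\pi .$$ (c) (factorization over interval partitions) If $\pi=\{\{1,\dots,k_1\},\{k_1+1,\dots,k_2\},\dots,\{k_{m-1}+1,\dots,k_m\}\}$ (with $k_m=n$) is an interval partition of $[n]$, and $\underline i\in\mathbb N^n$ satisfies $\ker\underline i=\pi$, then for all $\epsilon\in\{1,*,\prime\}^n$ $$\varphi\Big(T_{i(1)}^{\epsilon(1)}\cdots T_{i(n)}^{\epsilon(n)}\Big)=\varphi\big(T_{i(1)}^{\epsilon(1)}\cdots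 T_{i(k_1)}^{\epsilon(k_1)}\big)\,\varphi\big(T_{i(k_1+1)}^{\epsilon(k_1+1)}\cdots T_{i(k_2)}^{\epsilon(k_2)}\big)\cdots\varphi\big(T_{i(k_{m-1}+1)}^{\epsilon(k_{m-1}+1)}\cdots T_{i(k_m)}^{\epsilon(k_m)}\big).$$ (d) (commutation relation) There are real numbers $Q_{\epsilon,\epsilon'}(i,j)$ ($i\ne j$ in $\mathbb N$, $\epsilon,\epsilon'\in\{1,*,\prime\}$) such that $T_i^{\epsilon}T_j^{\epsilon'}=Q_{\epsilon,\epsilon'}(i,j)\,T_j^{\epsilon'}T_i^{\epsilon}$ for all $i\neq j$ and all $\epsilon,\epsilon'$. (e) (asymptotic existence) For every $n$, every $\epsilon\in\{1,*,\prime\}^{2n}$ and every $\pi_f\in\mathcal P^B_{2;\epsilon}(2n)$ the limit $$\lambda_{\pi_f}:=\lim_{N\to\infty}N^{-n}\sum_{\substack{i(1),\dots,i(2n)\in[N]\\ \ker\underline i=\pi}}\Big[\Xi(\pi_f,\underline i)\prod_{\substack{\{z,w\}\in\pi,\ z<w\\ f(\{z,w\})=1}}\varphi(T^*_{i(z)}T_{i(w)})\prod_{\substack{\{z,w\}\in\pi,\ z<w\\ f(\{z,w\})=-1}}\varphi(T^*_{i(z)}T'_{i(w)})\Big]$$ exists. For $N\ge1$ and $\epsilon\in\{1,*,\prime\}$ put $S_N^{\epsilon}=N^{-1/2}\sum_{i=1}^N T_i^{\epsilon}$. Then for every even $r\in\mathbb N$ and every $\epsilon\in\{1,*,\prime\}^r$,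 $$\lim_{N\to\infty}\varphi\big(S_N^{\epsilon(1)}\cdots S_N^{\epsilon(r)}\big)=\sum_{\pi_f\in\mathcal P^B_{2;\epsilon}(r)}\lambda_{\pi_f},$$ (the right-hand side being $0$ if $\mathcal P^B_{2;\epsilon}(r)=\emptyset$), and for every odd $r$ and every $\epsilon\in\{1,*,\prime\}^r$ this limit is $0$.
   Context: A noncommutative probability space $(\mathcal A,\varphi)$ is a $*$-algebra $\mathcal A$ (with antilinear $*$-operation) together with a positive, unital linear functional $\varphi:\mathcal A\to\mathbb C$. $[n]=\{1,\dots,n\}$. For a multiindex $\underline i=(i(1),\dots,i(n))\in\mathbb N^n$, $\ker\underline i$ is the set partition of $[n]$ in which $k\sim l$ iff $i(k)=i(l)$. A pair partition of $[n]$ ($n$ even) is a set partition all of whose blocks have exactly two elements. $\mathcal P^B_2(n)$ is the set of pair partitions of type B, i.e. of objects $\pi_f$ where $\pi$ is a pair partition of $[n]$ and $f:\pi\to\{1,-1\}$ is a colouring of its blocks. For $\epsilon=(\epsilon(1),\dots,\epsilon(n))\in\{1,*,\prime\}^n$, $\mathcal P^B_{2;\epsilon}(n)$ is the set of $\pi_f\in\mathcal P^B_2(n)$ such that for each block $\{z,w\}\in\pi$ with $z<w$: $\epsilon(z)=*$, and $\epsilon(w)=1$ if $f(\{z,w\})=1$, $\epsilon(w)=\prime$ if $f(\{z,w\})=-1$. For blocks $V,W$ of a pair partition: $V\stackrel{\mathrm{cr}}{\sim}W$ iff there exist $i,j\in V$, $k,l\in W$ with $i<k<j<l$; $V\stackrel{\mathrm{nest}}{\sim}W$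 iff there are $i,j\in V$ such that $i<k<j$ for every $k\in W$. For $\pi_f\in\mathcal P^B_{2;\epsilon}(2n)$ with $\pi=\{\{z_1,w_1\},\dots,\{z_n,w_n\}\}$, $z_j<w_j$, and $\underline i$ with $\ker\underline i=\pi$, and with the coefficients $Q_{\epsilon,\epsilon'}(i,j)$ of the commutation relation, $$\begin{aligned}\Xi(\pi_f,\underline i)=&\prod_{\substack{(j,k):\ \{z_j,w_j\}\stackrel{\mathrm{cr}}{\sim}\{z_k,w_k\}\\ f(\{z_j,w_j\})=1}}Q_{*,1}(i(z_k),i(w_j))\ \prod_{\substack{(j,k):\ \{z_j,w_j\}\stackrel{\mathrm{cr}}{\sim}\{z_k,w_k\}\\ f(\{z_j,w_j\})=-1}}Q_{*,\prime}(i(z_k),i(w_j))\\ &\times\prod_{\substack{(j,k):\ \{z_j,w_j\}\stackrel{\mathrm{nest}}{\sim}\{z_k,w_k\}\\ f(\{z_k,w_k\})=1}}Q_{*,*}(i(z_j),i(z_k))\,Q_{*,1}(i(z_j),i(w_k))\\ &\times\prod_{\substack{(j,k):\ \{z_j,w_j\}\stackrel{\mathrm{nest}}{\sim}\{z_k,w_k\}\\ f(\{z_k,w_k\})=-1}}Q_{*,*}(i(z_j),i(z_k))\,Q_{*,\prime}(i(z_j),i(w_k)).\end{aligned}$$ Here the crossing relation is oriented: $\{z_j,w_j\}\stackrel{\mathrm{cr}}{\sim}\{z_k,w_k\}$ means $z_j<z_k<w_j<w_k$. Empty products equal $1$. *)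

theory Defs
  imports "HOL-Analysis.Analysis"
begin

locale star_algebra = vector_space scaleC
  for scaleC :: "complex \<Rightarrow> 'a::ring_1 \<Rightarrow> 'a" +
  fixes star :: "'a \<Rightarrow> 'a"
  assumes scale_mult_left: "scaleC c x * y = scaleC c (x * y)"
    and scale_mult_right: "x * scaleC c y = scaleC c (x * y)"
    and star_star: "star (star x) = x"
    and star_add: "star (x + y) = star x + star y"
    and star_scale: "star (scaleC c x) = scaleC (cnj c) (star x)"
    and star_mult: "star (x * y) = star y * star x"

locale noncomm_prob_space = star_algebra scaleC star
  for scaleC :: "complex \<Rightarrow> 'a::ring_1 \<Rightarrow> 'a" and star :: "'a \<Rightarrow> 'a" +
  fixes \<phi> :: "'a \<Rightarrow> complex"
  assumes functional_linear: "Vector_Spaces.linear scaleC (*) \<phi>"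
    and functional_unital: "\<phi> 1 = 1"
    and functional_positive: "\<phi> (star x * x) \<in> \<real>\<^sub>\<ge>\<^sub>0"

text \<open>The exponents \<open>1\<close>, \<open>*\<close>, \<open>\<prime>\<close>. A family \<open>T :: label \<Rightarrow> nat \<Rightarrow> 'a\<close>
  collects the elements \<open>T\<^sub>i\<close>, \<open>T\<^sub>i\<^sup>*\<close>, \<open>T\<^sub>i'\<close> as \<open>T Plain i\<close>, \<open>T Star i\<close>, \<open>T Prime i\<close>.
  The index set is \<open>{1..}\<close>; the value of \<open>T\<close> at index 0 is irrelevant throughout.\<close>

datatype label = Plain | Star | Prime

definition word :: "(label \<Rightarrow> nat \<Rightarrow> 'a::monoid_mult) \<Rightarrow> (nat \<Rightarrow> nat) \<Rightarrow> (nat \<Rightarrow> label) \<Rightarrow> nat \<Rightarrow> nat \<Rightarrow> 'a"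
  where "word T i \<epsilon> a b = (\<Prod>l\<leftarrow>[a..<Suc b]. T (\<epsilon> l) (i l))"

definition index_kernel :: "nat \<Rightarrow> (nat \<Rightarrow> nat) \<Rightarrow> nat set set"
  where "index_kernel n i = {1..n} // {(k, l). k \<in> {1..n} \<and> l \<in> {1..n} \<and> i k = i l}"

definition pair_partitions :: "nat \<Rightarrow> nat set set set"
  where "pair_partitions n = {\<pi>. partition_on {1..n} \<pi> \<and> (\<forall>V\<in>\<pi>. card V = 2)}"

text \<open>Colourings are extensional, so that each coloured partition is counted once.\<close>

type_synonym coloured = "nat set set \<times> (nat set \<Rightarrow> int)"

definition pair_partitions_B :: "nat \<Rightarrow> coloured set"
  where "pair_partitions_B n = (SIGMA \<pi>:pair_partitions n. \<pi> \<rightarrow>\<^sub>E {1, -1})"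

definition pair_partitions_B_label :: "(nat \<Rightarrow> label) \<Rightarrow> nat \<Rightarrow> coloured set"
  where "pair_partitions_B_label \<epsilon> n =
    {(\<pi>, f) \<in> pair_partitions_B n. \<forall>z w. {z, w} \<in> \<pi> \<and> z < w \<longrightarrow>
        \<epsilon> z = Star \<and>
        (f {z, w} = 1 \<longrightarrow> \<epsilon> w = Plain) \<and>
        (f {z, w} = -1 \<longrightarrow> \<epsilon> w = Prime)}"

definition crosses :: "nat set \<Rightarrow> nat set \<Rightarrow> bool"
  where "crosses V W \<longleftrightarrow> (\<exists>i\<in>V. \<exists>j\<in>V. \<exists>k\<in>W. \<exists>l\<in>W. i < k \<and> k < j \<and> j < l)"

definition nests :: "nat set \<Rightarrow> nat set \<Rightarrow> bool"
  where "nests V W \<longleftrightarrow> (\<exists>i\<in>V. \<exists>j\<in>V. \<forall>k\<in>W. i < k \<and> k < j)"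

text \<open>On two-element blocks both relations are oriented.\<close>

lemma crosses_pair:
  assumes "z < w" "z' < w'"
  shows "crosses {z, w} {z', w'} \<longleftrightarrow> z < z' \<and> z' < w \<and> w < w'"
  using assms by (auto simp: crosses_def)

lemma nests_pair:
  assumes "z < w" "z' < w'"
  shows "nests {z, w} {z', w'} \<longleftrightarrow> z < z' \<and> w' < w"
  using assms by (auto simp: nests_def)

text \<open>For a block \<open>V = {z, w}\<close> with \<open>z < w\<close> we have \<open>z = Min V\<close> and \<open>w = Max V\<close>.
  The argument \<open>Q \<epsilon> \<epsilon>' i j\<close> is the coefficient in
  \<open>T\<^sub>i\<^sup>\<epsilon> T\<^sub>j\<^sup>\<epsilon>\<^sup>' = Q\<^sub>\<epsilon>\<^sub>,\<^sub>\<epsilon>\<^sub>'(i,j) T\<^sub>j\<^sup>\<epsilon>\<^sup>' T\<^sub>i\<^sup>\<epsilon>\<close>.\<close>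

definition Xi :: "(label \<Rightarrow> label \<Rightarrow> nat \<Rightarrow> nat \<Rightarrow> real) \<Rightarrow> coloured \<Rightarrow> (nat \<Rightarrow> nat) \<Rightarrow> real"
  where "Xi Q = (\<lambda>(\<pi>, f) i.
    (\<Prod>(V, W)\<in>{(V, W) \<in> \<pi> \<times> \<pi>. crosses V W \<and> f V = 1}.
        Q Star Plain (i (Min W)) (i (Max V))) *
    (\<Prod>(V, W)\<in>{(V, W) \<in> \<pi> \<times> \<pi>. crosses V W \<and> f V = -1}.
        Q Star Prime (i (Min W)) (i (Max V))) *
    (\<Prod>(V, W)\<in>{(V, W) \<in> \<pi> \<times> \<pi>. nests V W \<and> f W = 1}.
        Q Star Star (i (Min V)) (i (Min W)) * Q Star Plain (i (Min V)) (i (Max W))) *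
    (\<Prod>(V, W)\<in>{(V, W) \<in> \<pi> \<times> \<pi>. nests V W \<and> f W = -1}.
        Q Star Star (i (Min V)) (i (Min W)) * Q Star Prime (i (Min V)) (i (Max W))))"

text \<open>The \<open>N\<close>-th average whose limit is \<open>\<lambda>\<close>, for a coloured pair partition of \<open>{1..2 * n}\<close>.\<close>

definition lambda_seq :: "('a::ring_1 \<Rightarrow> complex) \<Rightarrow> (label \<Rightarrow> nat \<Rightarrow> 'a) \<Rightarrow>
    (label \<Rightarrow> label \<Rightarrow> nat \<Rightarrow> nat \<Rightarrow> real) \<Rightarrow> nat \<Rightarrow> coloured \<Rightarrow> nat \<Rightarrow> complex"
  where "lambda_seq \<phi> T Q n = (\<lambda>(\<pi>, f) N.
    (\<Sum>i\<in>{i \<in> {1..2 * n} \<rightarrow>\<^sub>E {1..N}. index_kernel (2 * n) i = \<pi>}.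
        complex_of_real (Xi Q (\<pi>, f) i) *
        (\<Prod>V\<in>{V \<in> \<pi>. f V = 1}. \<phi> (T Star (i (Min V)) * T Plain (i (Max V)))) *
        (\<Prod>V\<in>{V \<in> \<pi>. f V = -1}. \<phi> (T Star (i (Min V)) * T Prime (i (Max V)))))
      / of_nat N ^ n)"

definition lambda_lim :: "('a::ring_1 \<Rightarrow> complex) \<Rightarrow> (label \<Rightarrow> nat \<Rightarrow> 'a) \<Rightarrow>
    (label \<Rightarrow> label \<Rightarrow> nat \<Rightarrow> nat \<Rightarrow> real) \<Rightarrow> nat \<Rightarrow> coloured \<Rightarrow> complex"
  where "lambda_lim \<phi> T Q n \<pi>f = lim (lambda_seq \<phi> T Q n \<pi>f)"

definition normalized_sum :: "(complex \<Rightarrow> 'a::ring_1 \<Rightarrow> 'a) \<Rightarrow> (label \<Rightarrow> nat \<Rightarrow> 'a) \<Rightarrow> nat \<Rightarrow> label \<Rightarrow> 'a"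
  where "normalized_sum scaleC T N e = scaleC (complex_of_real (1 / sqrt (real N))) (\<Sum>i=1..N. T e i)"

end

(* Expand the moment over index tuples and group the tuples by their kernel.  Moving the letters of a
   word past each other gathers equal indices, so that the word becomes, up to the coefficients Q, a
   word over an interval partition and its moment factorizes over the blocks.  A singleton block
   therefore kills the moment, and a kernel with a block of size at least 3 and no singleton has
   fewer than r/2 blocks, so its contribution is O(N^(-1/2)).  Only pair partitions remain.  If the
   blocks are ordered by their right end points, the coefficient picked up is exactly Xi: the left
   leg of the later block crosses the right leg of the earlier one, and the left leg of an outer
   block jumps over both legs of a nested one.  Hence the contribution of a pair partition equals
   its lambda-average already at finite N. *)

theory Submission
  imports Defs
begin

subsection \<open>Kernels of index tuples\<close>

definition block_of :: "nat \<Rightarrow> (nat \<Rightarrow> nat) \<Rightarrow> nat \<Rightarrow> nat set"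
  where "block_of n i p = {q \<in> {1..n}. i q = i p}"

lemma finite_block_of [simp]: "finite (block_of n i p)"
  by (simp add: block_of_def)

lemma block_of_self: "p \<in> {1..n} \<Longrightarrow> p \<in> block_of n i p"
  by (simp add: block_of_def)

lemma Max_block_of_in:
  assumes "p \<in> {1..n}"
  shows "Max (block_of n i p) \<in> block_of n i p"
  using assms block_of_self by (intro Max_in) auto

text \<open>A block contains its own maximum, so equal maxima force a common index. Right end points
  thus form a natural-number sorting key that separates positions exactly when their indices
  differ.\<close>

lemma Max_block_of_eq_iff:
  assumes "p \<in> {1..n}" "q \<in> {1..n}"
  shows "Max (block_of n i p) = Max (block_of n i q) \<longleftrightarrow> i p = i q"
proof
  assume "Max (block_of n i p) = Max (block_of n i q)"
  moreover have "i (Max (block_of n i x)) = i x" if "x \<in> {1..n}" for x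
    using Max_block_of_in[OF that, of i] unfolding block_of_def by blast
  ultimately show "i p = i q"
    using assms by metis
qed (simp add: block_of_def)

lemma index_kernel_eq: "index_kernel n i = block_of n i ` {1..n}"
proof -
  have "{(k, l). k \<in> {1..n} \<and> l \<in> {1..n} \<and> i k = i l} `` {p} = block_of n i p" if "p \<in> {1..n}" for p
    using that by (auto simp: block_of_def)
  then show ?thesis unfolding index_kernel_def quotient_def by blast
qed

lemma partition_on_index_kernel: "partition_on {1..n} (index_kernel n i)"
  unfolding index_kernel_eq
  by (rule partition_onI) (auto simp: block_of_def disjnt_def)

lemma partition_on_finite_block:
  assumes "partition_on {1..n::nat} \<pi>" "V \<in> \<pi>"
  shows "finite V" "V \<subseteq> {1..n}" "V \<noteq> {}"
proof -
  show "V \<subseteq> {1..n}" "V \<noteq> {}" using assms by (auto simp: partition_on_def)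
  then show "finite V" by (auto intro: finite_subset)
qed

lemma mem_index_kernel_imp_block_of:
  assumes "V \<in> index_kernel n i" "p \<in> V"
  shows "V = block_of n i p"
  using assms by (auto simp: index_kernel_eq block_of_def)

lemma inj_on_Max_index_kernel: "inj_on Max (index_kernel n i)"
proof (rule inj_onI)
  fix V W assume V: "V \<in> index_kernel n i" and W: "W \<in> index_kernel n i" and eq: "Max V = Max W"
  then obtain p q where "p \<in> {1..n}" "q \<in> {1..n}" "V = block_of n i p" "W = block_of n i q"
    by (auto simp: index_kernel_eq)
  with eq show "V = W"
    using Max_block_of_eq_iff[of p n q i] by (simp add: block_of_def)
qed

lemma finite_pair_eq_Min_Max:
  fixes V :: "nat set"
  assumes "card V = 2"
  shows "V = {Min V, Max V}" "Min V < Max V"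
proof -
  from assms obtain a b where "V = {a, b}" "a \<noteq> b" by (auto simp: card_2_iff)
  then have "Min V = min a b" "Max V = max a b" by simp_all
  with \<open>V = {a, b}\<close> \<open>a \<noteq> b\<close> show "V = {Min V, Max V}" "Min V < Max V"
    by (auto simp: min_def max_def)
qed

lemma sorted_list_of_pair:
  fixes a b :: nat
  assumes "a < b"
  shows "sorted_list_of_set {a, b} = [a, b]"
  using assms sorted_list_of_set.idem_if_sorted_distinct[of "[a, b]"] by simp

subsection \<open>Rearranging words\<close>

text \<open>The scalar produced by a stable sort: one factor \<open>q x y\<close> for each
  \<open>x\<close> standing before a \<open>y\<close> of strictly smaller key. Letters with equal
  keys never pass each other, so no relation between them enters.\<close>

fun inversion_weight :: "('b \<Rightarrow> 'b \<Rightarrow> 'c::comm_monoid_mult) \<Rightarrow> ('b \<Rightarrow> nat) \<Rightarrow> 'b list \<Rightarrow> 'c"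
  where
    "inversion_weight q key [] = 1"
  | "inversion_weight q key (x # xs) =
      (\<Prod>y\<leftarrow>xs. if key y < key x then q x y else 1) * inversion_weight q key xs"

section \<open>Sorting a product of letters by means of the commutation relation\<close>

context star_algebra
begin

text \<open>In a sorted list the letters of smaller key form an initial segment. \<open>X x\<close>
  moves right past exactly these, one relation at a time, and stops where \<open>insort_key\<close>
  puts it, before any letter of equal key.\<close>

lemma commute_insort:
  assumes "\<And>y. y \<in> set ys \<Longrightarrow> key y < key x \<Longrightarrow> X x * X y = scaleC (q x y) (X y * X x)"
    and "sorted (map key ys)"
  shows "X x * (\<Prod>y\<leftarrow>ys. X y) =
    scaleC (\<Prod>y\<leftarrow>ys. if key y < key x then q x y else 1) (\<Prod>y\<leftarrow>insort_key key x ys. X y)"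
  using assms
proof (induction ys)
  case Nil
  then show ?case by simp
next
  case (Cons y ys)
  show ?case
  proof (cases "key x \<le> key y")
    case True
    \<comment> \<open>Here \<open>X x\<close> is already in place; sortedness makes every remaining
      factor of the weight trivial.\<close>
    then have "\<forall>z\<in>set ys. \<not> key z < key x"
      using Cons.prems(2) by auto
    then have "(\<Prod>y\<leftarrow>ys. if key y < key x then q x y else 1) = 1"
      by (induction ys) auto
    with True show ?thesis by auto
  next
    case False
    then have "X x * X y = scaleC (q x y) (X y * X x)"
      using Cons.prems(1)[of y] by simp
    then have "X x * X y * (\<Prod>y\<leftarrow>ys. X y) = scaleC (q x y) (X y * (X x * (\<Prod>y\<leftarrow>ys. X y)))"
      by (simp add: scale_mult_left mult.assoc)
    then have "X x * (X y * (\<Prod>y\<leftarrow>ys. X y)) = scaleC (q x y) (X y * (X x * (\<Prod>y\<leftarrow>ys. X y)))"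
      by (simp only: mult.assoc)
    also have "X x * (\<Prod>y\<leftarrow>ys. X y) =
      scaleC (\<Prod>y\<leftarrow>ys. if key y < key x then q x y else 1) (\<Prod>y\<leftarrow>insort_key key x ys. X y)"
      using Cons.prems by (intro Cons.IH) auto
    finally show ?thesis using False by (auto simp: scale_mult_right)
  qed
qed

text \<open>Insertion sort from the right end: the tail is sorted first, then the head letter is
  inserted into it.\<close>

lemma word_sort:
  assumes "\<And>x y. x \<in> set xs \<Longrightarrow> y \<in> set xs \<Longrightarrow> key y < key x \<Longrightarrow>
      X x * X y = scaleC (q x y) (X y * X x)"
  shows "(\<Prod>x\<leftarrow>xs. X x) = scaleC (inversion_weight q key xs) (\<Prod>x\<leftarrow>sort_key key xs. X x)"
  using assms
proof (induction xs)
  case Nil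
  then show ?case by simp
next
  case (Cons x xs)
  let ?ys = "sort_key key xs"
  have "(\<Prod>x\<leftarrow>xs. X x) = scaleC (inversion_weight q key xs) (\<Prod>x\<leftarrow>?ys. X x)"
    using Cons.prems by (intro Cons.IH) auto
  then have "(\<Prod>x\<leftarrow>x # xs. X x) = scaleC (inversion_weight q key xs) (X x * (\<Prod>x\<leftarrow>?ys. X x))"
    by (simp add: scale_mult_right)
  also have "X x * (\<Prod>x\<leftarrow>?ys. X x) =
      scaleC (\<Prod>y\<leftarrow>?ys. if key y < key x then q x y else 1) (\<Prod>y\<leftarrow>insort_key key x ?ys. X y)"
    using Cons.prems by (intro commute_insort) auto
  \<comment> \<open>The head passes through the sorted tail, whereas \<open>inversion_weight\<close>
    refers to the original tail; in a commutative monoid the product depends only on the multiset of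
    entries.\<close>
  also have "(\<Prod>y\<leftarrow>?ys. if key y < key x then q x y else 1) =
      (\<Prod>y\<leftarrow>xs. if key y < key x then q x y else 1)"
    by (simp flip: prod_mset_prod_list)
  finally show ?case by (simp add: mult.commute)
qed

end

text \<open>On an increasing list of positions, list order is numerical order, so the recursive
  weight becomes a product over a set of pairs, the shape needed for the comparison with
  \<open>Xi\<close>. The induction splits off the pairs with first entry \<open>a\<close>.\<close>

lemma inversion_weight_interval:
  fixes q :: "nat \<Rightarrow> nat \<Rightarrow> 'c::comm_monoid_mult"
  shows "inversion_weight q key [a..<b] =
    (\<Prod>(x, y)\<in>{(x, y). a \<le> x \<and> x < y \<and> y < b \<and> key y < key x}. q x y)"
proof (induction "b - a" arbitrary: a)
  case 0
  then have empty: "{(x, y). a \<le> x \<and> x < y \<and> y < b \<and> key y < key x} = {}" by auto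
  show ?case using 0 unfolding empty by simp
next
  case (Suc d)
  let ?I = "\<lambda>a. {(x, y). a \<le> x \<and> x < y \<and> y < b \<and> key y < key x}"
  let ?Y = "{y \<in> {Suc a..<b}. key y < key a}"
  from Suc.hyps(2) have "a < b" by simp
  have fin: "finite (?I c)" for c
    by (rule finite_subset[of _ "{..<b} \<times> {..<b}"]) auto
  have split: "?I a = Pair a ` ?Y \<union> ?I (Suc a)" by (auto simp: Suc_le_eq le_less)
  have "(\<Prod>y\<leftarrow>[Suc a..<b]. if key y < key a then q a y else 1) = (\<Prod>y\<in>?Y. q a y)"
    using prod.distinct_set_conv_list[OF distinct_upt, of "\<lambda>y. if key y < key a then q a y else 1" "Suc a" b]
    by (simp only: prod.inter_filter[OF finite_atLeastLessThan] set_upt)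
  also have "\<dots> = (\<Prod>(x, y)\<in>Pair a ` ?Y. q x y)"
    by (subst prod.reindex) (auto intro: inj_onI)
  finally have "inversion_weight q key [a..<b] =
      (\<Prod>(x, y)\<in>Pair a ` ?Y. q x y) * (\<Prod>(x, y)\<in>?I (Suc a). q x y)"
    using Suc.hyps \<open>a < b\<close> by (simp add: upt_conv_Cons del: upt_Suc)
  also have "\<dots> = (\<Prod>(x, y)\<in>?I a. q x y)"
    unfolding split by (rule prod.union_disjoint[symmetric]) (use fin in auto)
  finally show ?case .
qed

text \<open>A stable sort is determined by its multiset, its sortedness and the order inside each
  key class. The key classes, concatenated by increasing key, share these three properties.\<close>

lemma sort_key_eq_concat:
  "sort_key key xs = concat (map (\<lambda>v. filter (\<lambda>x. key x = v) xs) (sorted_list_of_set (key ` set xs)))"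
    (is "_ = concat (map ?B ?vs)")
proof (rule properties_for_sort_key)
  \<comment> \<open>Stated for arbitrary distinct \<open>vs\<close>, since the induction runs over
    the list of keys while \<open>xs\<close> stays fixed.\<close>
  have "mset (concat (map ?B vs)) = mset (filter (\<lambda>x. key x \<in> set vs) xs)" if "distinct vs" for vs
    using that
  proof (induction vs)
    case (Cons v vs)
    have "filter_mset (\<lambda>x. key x = v \<or> key x \<in> set vs) (mset xs) =
        filter_mset (\<lambda>x. key x = v) (mset xs) + filter_mset (\<lambda>x. key x \<in> set vs) (mset xs)"
      using Cons.prems by (induction xs) auto
    with Cons show ?case by simp
  qed simp
  from this[of ?vs] show "mset (concat (map ?B ?vs)) = mset xs"
    by (simp add: filter_id_conv cong: filter_cong)
next
  fix k assume "k \<in> set (concat (map ?B ?vs))"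
  then have k: "key k \<in> set ?vs" by auto
  have "filter (\<lambda>x. key k = key x) (concat (map ?B vs)) =
      (if key k \<in> set vs then filter (\<lambda>x. key k = key x) xs else [])" if "distinct vs" for vs
    using that
    by (induction vs) (auto simp: filter_empty_conv conj_commute intro!: filter_cong)
  from this[of ?vs] k show "filter (\<lambda>x. key k = key x) (concat (map ?B ?vs)) = filter (\<lambda>x. key k = key x) xs"
    by simp
next
  have "sorted (map key (concat (map ?B vs)))" if "sorted vs" for vs
    using that by (induction vs) (auto simp: sorted_append sorted_map_same[where g = "\<lambda>_. _"])
  then show "sorted (map key (concat (map ?B ?vs)))" by simp
qed

subsection \<open>Moments of words\<close>

text \<open>The seven vanishing second moments belong to all label pairs except \<open>Star\<close>
  followed by \<open>Plain\<close> or \<open>Prime\<close>; this is the side condition of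
  \<open>second_moments\<close>.\<close>

locale clt_family = noncomm_prob_space scaleC star \<phi>
  for scaleC :: "complex \<Rightarrow> 'a::ring_1 \<Rightarrow> 'a" and star :: "'a \<Rightarrow> 'a" and \<phi> :: "'a \<Rightarrow> complex" +
  fixes T :: "label \<Rightarrow> nat \<Rightarrow> 'a"
    and Q :: "label \<Rightarrow> label \<Rightarrow> nat \<Rightarrow> nat \<Rightarrow> real"
  assumes means: "i \<ge> 1 \<Longrightarrow> \<phi> (T e i) = 0"
    and second_moments: "i \<ge> 1 \<Longrightarrow> \<not> (e = Star \<and> e' \<noteq> Star) \<Longrightarrow> \<phi> (T e i * T e' i) = 0"
    and bounds: "partition_on {1..n} \<pi> \<Longrightarrow>
        \<exists>\<rho>\<ge>0::real. \<forall>i \<in> {1..n} \<rightarrow> {1..}. \<forall>\<epsilon>.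
           index_kernel n i = \<pi> \<longrightarrow> cmod (\<phi> (word T i \<epsilon> 1 n)) \<le> \<rho>"
    and factorization: "h \<in> {1..k m} \<rightarrow> {1..} \<Longrightarrow> k 0 = 0 \<Longrightarrow> (\<And>j. j < m \<Longrightarrow> k j < k (Suc j)) \<Longrightarrow>
        index_kernel (k m) h = (\<lambda>j. {k j + 1..k (Suc j)}) ` {..<m} \<Longrightarrow>
        \<phi> (word T h \<epsilon> 1 (k m)) = (\<Prod>j<m. \<phi> (word T h \<epsilon> (k j + 1) (k (Suc j))))"
    and commutation: "i \<ge> 1 \<Longrightarrow> j \<ge> 1 \<Longrightarrow> i \<noteq> j \<Longrightarrow>
        T e i * T e' j = scaleC (complex_of_real (Q e e' i j)) (T e' j * T e i)"
begin

sublocale functional: Vector_Spaces.linear scaleC "(*)" \<phi>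
  by (rule functional_linear)

text \<open>Factorization is available for tuples whose kernel consists of intervals. A
  concatenation of constant runs with distinct indices becomes such a tuple once its letters are
  renumbered by their place in the word, however scattered the original positions \<open>p\<close>
  are.\<close>

lemma functional_concat:
  assumes "distinct vs" and nonempty: "\<And>v. v \<in> set vs \<Longrightarrow> B v \<noteq> []"
    and index: "\<And>v p. v \<in> set vs \<Longrightarrow> p \<in> set (B v) \<Longrightarrow> i p = c v"
    and "inj_on c (set vs)" and pos: "\<And>v. v \<in> set vs \<Longrightarrow> c v \<ge> 1"
  shows "\<phi> (\<Prod>p\<leftarrow>concat (map B vs). T (\<epsilon> p) (i p)) = (\<Prod>v\<leftarrow>vs. \<phi> (\<Prod>p\<leftarrow>B v. T (\<epsilon> p) (i p)))"
proof -
  define ys where "ys = concat (map B vs)"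
  \<comment> \<open>Run \<open>j\<close> occupies the places \<open>k j + 1\<close> to
    \<open>k (Suc j)\<close>. Places count from 1 and list entries from 0, hence the shift
    \<open>l - 1\<close> below.\<close>
  define k where "k j = length (concat (map B (take j vs)))" for j
  define i' where "i' l = i (ys ! (l - 1))" for l
  define \<epsilon>' where "\<epsilon>' l = \<epsilon> (ys ! (l - 1))" for l
  let ?m = "length vs"
  let ?I = "\<lambda>j. {k j + 1..k (Suc j)}"
  have k_Suc: "k (Suc j) = k j + length (B (vs ! j))" if "j < ?m" for j
    using that by (simp add: k_def take_Suc_conv_app_nth)
  have k_less: "k j < k (Suc j)" if "j < ?m" for j
    using nonempty[of "vs ! j"] that by (simp add: k_Suc)
  have "k j \<le> k (Suc j)" for j
    using k_less[of j] by (cases "j < ?m") (auto simp: k_def)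
  then have k_mono: "k j \<le> k j'" if "j \<le> j'" for j j'
    using that by (rule lift_Suc_mono_le)
  have k_m: "k ?m = length ys" by (simp add: k_def ys_def)
  have nth: "ys ! (k j + t) = B (vs ! j) ! t" if "j < ?m" "t < length (B (vs ! j))" for j t
  proof -
    have "ys = concat (map B (take j vs)) @ B (vs ! j) @ concat (map B (drop (Suc j) vs))"
      unfolding ys_def by (subst id_take_nth_drop[OF that(1)]) simp
    then show ?thesis using that(2) by (simp add: k_def nth_append)
  qed
  have cover: "\<exists>j<m'. l \<in> ?I j" if "l \<in> {1..k m'}" for m' l
    using that
  proof (induction m')
    case 0
    then show ?case by (simp add: k_def)
  next
    case (Suc m')
    then show ?case by (cases "l \<le> k m'") (auto intro: less_SucI)
  qed
  have i': "i' l = c (vs ! j)" if "j < ?m" "l \<in> ?I j" for j l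
  proof -
    define t where "t = l - Suc (k j)"
    then have "l = Suc (k j + t)" "t < length (B (vs ! j))"
      using that k_Suc[OF that(1)] by auto
    then show ?thesis
      using that(1) nth[of j t] index[of "vs ! j" "B (vs ! j) ! t"] by (simp add: i'_def)
  qed
  \<comment> \<open>Distinct runs have distinct indices by injectivity of \<open>c\<close>, so a
    kernel class cannot reach beyond its own run.\<close>
  have block: "block_of (k ?m) i' l = ?I j" if "j < ?m" "l \<in> ?I j" for j l
  proof (rule set_eqI)
    fix q
    have "q \<in> ?I j" if q: "q \<in> {1..k ?m}" "i' q = i' l"
    proof -
      from cover[OF q(1)] obtain j' where j': "j' < ?m" "q \<in> ?I j'" by blast
      with q(2) i' \<open>j < ?m\<close> \<open>l \<in> ?I j\<close> have "c (vs ! j') = c (vs ! j)" by metis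
      with j' \<open>j < ?m\<close> assms(1,4) have "j' = j"
        by (metis inj_onD nth_eq_iff_index_eq nth_mem)
      with j' show ?thesis by simp
    qed
    moreover have "q \<in> {1..k ?m}" if "q \<in> ?I j"
      using that k_mono[of "Suc j" ?m] \<open>j < ?m\<close> by simp
    moreover have "i' q = i' l" if "q \<in> ?I j"
      using i' that \<open>j < ?m\<close> \<open>l \<in> ?I j\<close> by simp
    ultimately show "q \<in> block_of (k ?m) i' l \<longleftrightarrow> q \<in> ?I j"
      unfolding block_of_def by blast
  qed
  have kernel: "index_kernel (k ?m) i' = ?I ` {..<?m}"
    unfolding index_kernel_eq
  proof (intro equalityI image_subsetI)
    fix l assume "l \<in> {1..k ?m}"
    with cover block show "block_of (k ?m) i' l \<in> ?I ` {..<?m}" by blast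
  next
    fix j assume "j \<in> {..<?m}"
    then have "j < ?m" by simp
    then have "k (Suc j) \<in> ?I j" "k (Suc j) \<in> {1..k ?m}"
      using k_less[of j] k_mono[of "Suc j" ?m] by simp_all
    with block \<open>j < ?m\<close> show "?I j \<in> block_of (k ?m) i' ` {1..k ?m}" by (metis imageI)
  qed
  have "i' \<in> {1..k ?m} \<rightarrow> {1..}"
  proof
    fix l assume "l \<in> {1..k ?m}"
    with cover obtain j where "j < ?m" "l \<in> ?I j" by blast
    with i' pos[of "vs ! j"] show "i' l \<in> {1..}" by simp
  qed
  then have "\<phi> (word T i' \<epsilon>' 1 (k ?m)) = (\<Prod>j<?m. \<phi> (word T i' \<epsilon>' (k j + 1) (k (Suc j))))"
    using k_less kernel by (intro factorization) (auto simp: k_def)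
  also have "word T i' \<epsilon>' 1 (k ?m) = (\<Prod>p\<leftarrow>ys. T (\<epsilon> p) (i p))"
    unfolding word_def k_m
    by (rule arg_cong[where f = prod_list], rule nth_equalityI)
      (auto simp: i'_def \<epsilon>'_def simp del: upt_Suc)
  also have "(\<Prod>j<?m. \<phi> (word T i' \<epsilon>' (k j + 1) (k (Suc j)))) =
      (\<Prod>j<?m. \<phi> (\<Prod>p\<leftarrow>B (vs ! j). T (\<epsilon> p) (i p)))"
  proof (rule prod.cong[OF refl])
    fix j assume "j \<in> {..<?m}"
    then have "map (\<lambda>l. T (\<epsilon>' l) (i' l)) [k j + 1..<Suc (k (Suc j))] =
        map (\<lambda>p. T (\<epsilon> p) (i p)) (B (vs ! j))"
      by (intro nth_equalityI) (auto simp: i'_def \<epsilon>'_def k_Suc nth simp del: upt_Suc)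
    then show "\<phi> (word T i' \<epsilon>' (k j + 1) (k (Suc j))) = \<phi> (\<Prod>p\<leftarrow>B (vs ! j). T (\<epsilon> p) (i p))"
      unfolding word_def by simp
  qed
  also have "\<dots> = (\<Prod>v\<leftarrow>vs. \<phi> (\<Prod>p\<leftarrow>B v. T (\<epsilon> p) (i p)))"
    by (simp add: prod.list_conv_set_nth atLeast0LessThan)
  finally show ?thesis unfolding ys_def .
qed

text \<open>Letters with different keys have different indices, so the word can be sorted by key and
  the sorted word factorizes. Stability keeps the positions of each block in increasing order, which
  explains \<open>sorted_list_of_set V\<close>.\<close>

lemma functional_word:
  assumes pos: "i \<in> {1..n} \<rightarrow> {1..}"
  shows "\<phi> (word T i \<epsilon> 1 n) =
    complex_of_real (\<Prod>(p, q)\<in>{(p, q). 1 \<le> p \<and> p < q \<and> q \<le> n \<and> Max (block_of n i q) < Max (block_of n i p)}.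
      Q (\<epsilon> p) (\<epsilon> q) (i p) (i q)) *
    (\<Prod>V\<in>index_kernel n i. \<phi> (\<Prod>p\<leftarrow>sorted_list_of_set V. T (\<epsilon> p) (i p)))"
proof -
  define key where "key p = Max (block_of n i p)" for p
  define X where "X p = T (\<epsilon> p) (i p)" for p
  define q where "q p p' = complex_of_real (Q (\<epsilon> p) (\<epsilon> p') (i p) (i p'))" for p p'
  let ?xs = "[1..<Suc n]"
  let ?B = "\<lambda>v. filter (\<lambda>p. key p = v) ?xs"
  let ?vs = "sorted_list_of_set (key ` {1..n})"
  have set_xs: "set ?xs = {1..n}" by auto
  \<comment> \<open>A key is itself a position of the block it stands for. Hence \<open>i v\<close>
    is the common index of the run with key \<open>v\<close>, and \<open>i\<close> can serve as the
    map \<open>c\<close> of \<open>functional_concat\<close>.\<close>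
  have i_key: "i (key p) = i p" if "p \<in> {1..n}" for p
    using Max_block_of_in[OF that, of i] unfolding block_of_def key_def by blast
  have key_eq: "key p = key p' \<longleftrightarrow> i p = i p'" if "p \<in> {1..n}" "p' \<in> {1..n}" for p p'
    unfolding key_def by (rule Max_block_of_eq_iff[OF that])
  have "word T i \<epsilon> 1 n = (\<Prod>p\<leftarrow>?xs. X p)" by (simp add: word_def X_def)
  also have "\<dots> = scaleC (inversion_weight q key ?xs) (\<Prod>p\<leftarrow>sort_key key ?xs. X p)"
  proof (rule word_sort)
    fix x y assume "x \<in> set ?xs" "y \<in> set ?xs" "key y < key x"
    then show "X x * X y = scaleC (q x y) (X y * X x)"
      unfolding X_def q_def set_xs using pos key_eq[of x y]
      by (intro commutation) (auto simp: Pi_iff)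
  qed
  finally have "\<phi> (word T i \<epsilon> 1 n) = inversion_weight q key ?xs * \<phi> (\<Prod>p\<leftarrow>sort_key key ?xs. X p)"
    by (simp add: functional.scale)
  also have "inversion_weight q key ?xs = complex_of_real
      (\<Prod>(p, p')\<in>{(p, p'). 1 \<le> p \<and> p < p' \<and> p' \<le> n \<and> key p' < key p}. Q (\<epsilon> p) (\<epsilon> p') (i p) (i p'))"
    unfolding inversion_weight_interval q_def of_real_prod less_Suc_eq_le
    by (rule prod.cong) auto
  also have "\<phi> (\<Prod>p\<leftarrow>sort_key key ?xs. X p) = (\<Prod>v\<leftarrow>?vs. \<phi> (\<Prod>p\<leftarrow>?B v. X p))"
    unfolding sort_key_eq_concat set_xs X_def
  proof (rule functional_concat)
    show "?B v \<noteq> []" if "v \<in> set ?vs" for v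
      using that by (auto simp: filter_empty_conv simp del: upt_Suc)
    show "i p = i v" if "v \<in> set ?vs" "p \<in> set (?B v)" for v p
      using that by (auto simp: i_key simp flip: key_eq simp del: upt_Suc)
    show "inj_on i (set ?vs)"
      using key_eq by (auto simp: inj_on_def i_key)
    show "1 \<le> i v" if "v \<in> set ?vs" for v
      using that pos by (auto simp: i_key Pi_iff)
  qed simp
  also have "\<dots> = (\<Prod>v\<in>key ` {1..n}. \<phi> (\<Prod>p\<leftarrow>?B v. X p))"
    by (simp add: prod.distinct_set_conv_list[symmetric] del: upt_Suc)
  also have "key ` {1..n} = Max ` index_kernel n i"
    by (simp add: index_kernel_eq key_def image_image)
  also have "(\<Prod>v\<in>Max ` index_kernel n i. \<phi> (\<Prod>p\<leftarrow>?B v. X p)) =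
      (\<Prod>V\<in>index_kernel n i. \<phi> (\<Prod>p\<leftarrow>?B (Max V). X p))"
    by (simp add: prod.reindex[OF inj_on_Max_index_kernel] del: upt_Suc)
  also have "\<dots> = (\<Prod>V\<in>index_kernel n i. \<phi> (\<Prod>p\<leftarrow>sorted_list_of_set V. X p))"
  proof (rule prod.cong[OF refl])
    fix V assume V: "V \<in> index_kernel n i"
    then obtain p where p: "p \<in> {1..n}" "V = block_of n i p" by (auto simp: index_kernel_eq)
    have "set (?B (Max V)) = {r \<in> {1..n}. key r = key p}"
      using set_xs by (auto simp: p(2) key_def)
    also have "\<dots> = V"
      using key_eq p by (auto simp: block_of_def)
    \<comment> \<open>A filter of a strictly increasing list is again strictly increasing, hence the
      sorted list of its own set.\<close>
    finally have "?B (Max V) = sorted_list_of_set V"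
      using sorted_list_of_set.idem_if_sorted_distinct[of "?B (Max V)"]
      by (simp add: sorted_wrt_filter del: upt_Suc)
    then show "\<phi> (\<Prod>p\<leftarrow>?B (Max V). X p) = \<phi> (\<Prod>p\<leftarrow>sorted_list_of_set V. X p)" by simp
  qed
  finally show ?thesis unfolding key_def X_def .
qed

text \<open>The factor of a singleton block in \<open>functional_word\<close> is a mean.\<close>

lemma functional_word_singleton:
  assumes "i \<in> {1..n} \<rightarrow> {1..}" "V \<in> index_kernel n i" "card V = 1"
  shows "\<phi> (word T i \<epsilon> 1 n) = 0"
proof -
  from assms(3) obtain p where "V = {p}" by (rule card_1_singletonE)
  moreover from this assms(2) have "p \<in> {1..n}" by (auto simp: index_kernel_eq block_of_def)
  ultimately have "\<phi> (\<Prod>p\<leftarrow>sorted_list_of_set V. T (\<epsilon> p) (i p)) = 0"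
    using assms(1) by (auto simp: means Pi_iff)
  then show ?thesis
    unfolding functional_word[OF assms(1)] using assms(2) by (auto simp: index_kernel_eq)
qed

end

subsection \<open>Pair partitions and the weight Xi\<close>

lemma pair_partitionsD:
  assumes "\<pi> \<in> pair_partitions n"
  shows "partition_on {1..n} \<pi>" "finite \<pi>" "V \<in> \<pi> \<Longrightarrow> card V = 2"
    "V \<in> \<pi> \<Longrightarrow> V = {Min V, Max V}" "V \<in> \<pi> \<Longrightarrow> Min V < Max V"
  using assms finite_pair_eq_Min_Max[of V] finite_elements[of "{1..n}" \<pi>]
  by (auto simp: pair_partitions_def)

lemma pair_partitions_crosses_iff:
  assumes "\<pi> \<in> pair_partitions n" "V \<in> \<pi>" "W \<in> \<pi>"
  shows "crosses V W \<longleftrightarrow> Min V < Min W \<and> Min W < Max V \<and> Max V < Max W"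
  using crosses_pair[of "Min V" "Max V" "Min W" "Max W"] pair_partitionsD(4,5)[OF assms(1)] assms(2,3)
  by metis

lemma pair_partitions_nests_iff:
  assumes "\<pi> \<in> pair_partitions n" "V \<in> \<pi>" "W \<in> \<pi>"
  shows "nests V W \<longleftrightarrow> Min V < Min W \<and> Max W < Max V"
  using nests_pair[of "Min V" "Max V" "Min W" "Max W"] pair_partitionsD(4,5)[OF assms(1)] assms(2,3)
  by metis

text \<open>By disjointness of blocks, an end point determines both its block and its side. This
  later ensures that no pair of legs is counted twice.\<close>

lemma pair_partitions_block_unique:
  assumes "\<pi> \<in> pair_partitions n" "V \<in> \<pi>" "W \<in> \<pi>"
  shows "Min V = Min W \<longleftrightarrow> V = W" "Max V = Max W \<longleftrightarrow> V = W" "Min V \<noteq> Max W"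
proof -
  have mem: "Min V \<in> V" "Max V \<in> V" "Min W \<in> W" "Max W \<in> W"
    using pair_partitionsD(4)[OF assms(1)] assms(2,3) by blast+
  have eq: "V = W" if "x \<in> V" "x \<in> W" for x
    using pair_partitionsD(1)[OF assms(1)] assms(2,3) that
    by (auto simp: partition_on_def disjoint_def)
  show "Min V = Min W \<longleftrightarrow> V = W" "Max V = Max W \<longleftrightarrow> V = W"
    using eq mem by metis+
  show "Min V \<noteq> Max W"
    using eq mem pair_partitionsD(5)[OF assms(1,2)] by (metis less_irrefl)
qed

text \<open>An inversion goes from a left leg to a later leg of a block that ends earlier. If that
  block lies inside, both of its legs qualify; if it crosses from the left, only its right leg
  does.\<close>

lemma pair_partition_inversions:
  assumes \<pi>: "\<pi> \<in> pair_partitions n" and kernel: "index_kernel n i = \<pi>"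
  defines "C \<equiv> {(V, W) \<in> \<pi> \<times> \<pi>. crosses V W}" and "N \<equiv> {(V, W) \<in> \<pi> \<times> \<pi>. nests V W}"
  shows "{(p, q). 1 \<le> p \<and> p < q \<and> q \<le> n \<and> Max (block_of n i q) < Max (block_of n i p)} =
    (\<lambda>(V, W). (Min W, Max V)) ` C \<union>
      ((\<lambda>(V, W). (Min V, Min W)) ` N \<union> (\<lambda>(V, W). (Min V, Max W)) ` N)" (is "?I = ?R")
proof (intro equalityI subsetI)
  have block: "block_of n i p = V" if "V \<in> \<pi>" "p \<in> V" for p V
    using mem_index_kernel_imp_block_of that kernel by metis
  note pair = pair_partitionsD[OF \<pi>]
  note iffs = pair_partitions_crosses_iff[OF \<pi>] pair_partitions_nests_iff[OF \<pi>]
  show "x \<in> ?R" if "x \<in> ?I" for x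
  proof -
    from that obtain p q where x: "x = (p, q)" and pq: "1 \<le> p" "p < q" "q \<le> n"
      and "Max (block_of n i q) < Max (block_of n i p)" by auto
    moreover define V W where "V = block_of n i p" and "W = block_of n i q"
    ultimately have less: "Max W < Max V" by simp
    have V: "V \<in> \<pi>" "p \<in> V" and W: "W \<in> \<pi>" "q \<in> W"
      using pq kernel by (auto simp: V_def W_def index_kernel_eq block_of_def)
    \<comment> \<open>If \<open>p\<close> were the right leg of \<open>V\<close>, then
      \<open>q\<close> would lie beyond \<open>Max V\<close>, although its block \<open>W\<close>
      ends before \<open>Max V\<close>.\<close>
    have "q \<le> Max W" using W pair(4)[of W] by (metis Max_ge finite.emptyI finite.insertI)
    with pq less have "p \<noteq> Max V" by simp
    then have p: "p = Min V" using V pair(4)[of V] by blast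
    have "q = Min W \<or> q = Max W" using W pair(4)[of W] by blast
    moreover have "(V, W) \<in> N" if "q = Min W"
      using that iffs V W p pq less by (simp add: N_def)
    moreover have "(V, W) \<in> N \<or> (W, V) \<in> C" if "q = Max W"
    proof -
      \<comment> \<open>The order of the left legs decides: \<open>V\<close> nests \<open>W\<close>
        if \<open>V\<close> starts first, and \<open>W\<close> crosses \<open>V\<close> otherwise.
        The roles are swapped in \<open>C\<close> because its first block is the one that ends
        first.\<close>
      have "Min V \<noteq> Min W" using pair_partitions_block_unique(1)[OF \<pi> V(1) W(1)] less by auto
      then show ?thesis
        using that iffs V W p pq less by (auto simp: N_def C_def)
    qed
    ultimately show ?thesis unfolding x p by force
  qed
  show "x \<in> ?I" if "x \<in> ?R" for x
  proof -
    have mem: "1 \<le> Min V \<and> Max V \<le> n \<and> block_of n i (Min V) = V \<and> block_of n i (Max V) = V \<and> Min V < Max V"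
      if "V \<in> \<pi>" for V
    proof -
      have "V \<subseteq> {1..n}" using partition_on_finite_block(2)[OF pair(1) that] .
      moreover have "Min V \<in> V" "Max V \<in> V" using pair(4)[OF that] by blast+
      ultimately show ?thesis using block[OF that] pair(5)[OF that] by auto
    qed
    from that consider
      V W where "V \<in> \<pi>" "W \<in> \<pi>" "crosses V W" "x = (Min W, Max V)"
      | V W where "V \<in> \<pi>" "W \<in> \<pi>" "nests V W" "x = (Min V, Min W)"
      | V W where "V \<in> \<pi>" "W \<in> \<pi>" "nests V W" "x = (Min V, Max W)"
      by (auto simp: C_def N_def)
    then show ?thesis
    proof cases
      case 1 then show ?thesis using iffs[of V W] mem[of V] mem[of W] by auto
    next
      case 2 then show ?thesis using iffs[of V W] mem[of V] mem[of W] by auto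
    next
      case 3 then show ?thesis using iffs[of V W] mem[of V] mem[of W] by auto
    qed
  qed
qed

lemma prod_pair_partition_inversions:
  fixes g :: "nat \<Rightarrow> nat \<Rightarrow> 'c::comm_monoid_mult"
  assumes \<pi>: "\<pi> \<in> pair_partitions n" and kernel: "index_kernel n i = \<pi>"
  shows "(\<Prod>(p, q)\<in>{(p, q). 1 \<le> p \<and> p < q \<and> q \<le> n \<and> Max (block_of n i q) < Max (block_of n i p)}. g p q) =
    (\<Prod>(V, W)\<in>{(V, W) \<in> \<pi> \<times> \<pi>. crosses V W}. g (Min W) (Max V)) *
    (\<Prod>(V, W)\<in>{(V, W) \<in> \<pi> \<times> \<pi>. nests V W}. g (Min V) (Min W) * g (Min V) (Max W))"
proof -
  define C where "C = {(V, W) \<in> \<pi> \<times> \<pi>. crosses V W}"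
  define N where "N = {(V, W) \<in> \<pi> \<times> \<pi>. nests V W}"
  let ?c = "\<lambda>(V, W). (Min W, Max V)"
    and ?a = "\<lambda>(V, W). (Min V, Min W)" and ?b = "\<lambda>(V, W). (Min V, Max W)"
  note iffs = pair_partitions_crosses_iff[OF \<pi>] pair_partitions_nests_iff[OF \<pi>]
  note unique = pair_partitions_block_unique[OF \<pi>]
  have fin: "finite C" "finite N"
    unfolding C_def N_def
    using pair_partitionsD(2)[OF \<pi>] by (auto intro: finite_subset[of _ "\<pi> \<times> \<pi>"])
  have inj: "inj_on ?c C" "inj_on ?a N" "inj_on ?b N"
    unfolding inj_on_def C_def N_def using unique by auto
  \<comment> \<open>Pairs of two left legs differ from pairs ending in a right leg. A crossing and a
    nesting with the same pair of legs would involve the same two blocks with contradictory orders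
    of left legs.\<close>
  have disj: "?c ` C \<inter> (?a ` N \<union> ?b ` N) = {}" "?a ` N \<inter> ?b ` N = {}"
    unfolding C_def N_def using unique iffs by (fastforce dest: sym)+
  have "(\<Prod>(p, q)\<in>?c ` C \<union> (?a ` N \<union> ?b ` N). g p q) =
      (\<Prod>(p, q)\<in>?c ` C. g p q) * ((\<Prod>(p, q)\<in>?a ` N. g p q) * (\<Prod>(p, q)\<in>?b ` N. g p q))"
    using fin disj by (simp add: prod.union_disjoint)
  also have "\<dots> = (\<Prod>(V, W)\<in>C. g (Min W) (Max V)) *
      (\<Prod>(V, W)\<in>N. g (Min V) (Min W) * g (Min V) (Max W))"
    unfolding prod.reindex[OF inj(1)] prod.reindex[OF inj(2)] prod.reindex[OF inj(3)]
    by (simp add: prod.distrib[symmetric] case_prod_unfold)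
  finally show ?thesis
    unfolding pair_partition_inversions[OF assms] C_def N_def .
qed

text \<open>Singles out the pairings none of whose blocks carries one of the vanishing second
  moments.\<close>

definition admissible :: "(nat \<Rightarrow> label) \<Rightarrow> nat set set \<Rightarrow> bool"
  where "admissible \<epsilon> \<pi> \<longleftrightarrow> (\<forall>V\<in>\<pi>. \<epsilon> (Min V) = Star \<and> \<epsilon> (Max V) \<noteq> Star)"

text \<open>The only colouring compatible with the labels of an admissible pairing. The restriction
  to \<open>\<pi>\<close> matches the extensional colourings of
  \<open>pair_partitions_B\<close>.\<close>

definition colour :: "(nat \<Rightarrow> label) \<Rightarrow> nat set set \<Rightarrow> nat set \<Rightarrow> int"
  where "colour \<epsilon> \<pi> = (\<lambda>V\<in>\<pi>. if \<epsilon> (Max V) = Plain then 1 else -1)"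

text \<open>The label of the right leg forces the colour of each block, so summing over coloured
  pairings amounts to summing over admissible ones.\<close>

lemma pair_partitions_B_label_eq:
  "pair_partitions_B_label \<epsilon> n = (\<lambda>\<pi>. (\<pi>, colour \<epsilon> \<pi>)) ` {\<pi> \<in> pair_partitions n. admissible \<epsilon> \<pi>}"
proof (intro equalityI subsetI)
  fix x assume "x \<in> pair_partitions_B_label \<epsilon> n"
  then obtain \<pi> f where x: "x = (\<pi>, f)" and \<pi>: "\<pi> \<in> pair_partitions n" and f: "f \<in> \<pi> \<rightarrow>\<^sub>E {1, -1}"
    and label: "\<And>z w. {z, w} \<in> \<pi> \<Longrightarrow> z < w \<Longrightarrow>
      \<epsilon> z = Star \<and> (f {z, w} = 1 \<longrightarrow> \<epsilon> w = Plain) \<and> (f {z, w} = -1 \<longrightarrow> \<epsilon> w = Prime)"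
    by (auto simp: pair_partitions_B_label_def pair_partitions_B_def)
  have block: "\<epsilon> (Min V) = Star \<and> (f V = 1 \<and> \<epsilon> (Max V) = Plain \<or> f V = -1 \<and> \<epsilon> (Max V) = Prime)"
    if "V \<in> \<pi>" for V
    using label[of "Min V" "Max V"] pair_partitionsD(4,5)[OF \<pi> that] that PiE_mem[OF f that] by auto
  have "admissible \<epsilon> \<pi>" using block by (fastforce simp: admissible_def)
  moreover have "f = colour \<epsilon> \<pi>"
  proof
    fix V show "f V = colour \<epsilon> \<pi> V"
    proof (cases "V \<in> \<pi>")
      case True
      with block[OF True] show ?thesis by (auto simp: colour_def)
    next
      case False
      with PiE_arb[OF f False] show ?thesis by (simp add: colour_def)
    qed
  qed
  ultimately show "x \<in> (\<lambda>\<pi>. (\<pi>, colour \<epsilon> \<pi>)) ` {\<pi> \<in> pair_partitions n. admissible \<epsilon> \<pi>}"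
    using x \<pi> by blast
next
  fix x assume "x \<in> (\<lambda>\<pi>. (\<pi>, colour \<epsilon> \<pi>)) ` {\<pi> \<in> pair_partitions n. admissible \<epsilon> \<pi>}"
  then obtain \<pi> where x: "x = (\<pi>, colour \<epsilon> \<pi>)" and \<pi>: "\<pi> \<in> pair_partitions n" "admissible \<epsilon> \<pi>" by auto
  have "\<epsilon> z = Star \<and> (colour \<epsilon> \<pi> {z, w} = 1 \<longrightarrow> \<epsilon> w = Plain) \<and> (colour \<epsilon> \<pi> {z, w} = -1 \<longrightarrow> \<epsilon> w = Prime)"
    if "{z, w} \<in> \<pi>" "z < w" for z w
  proof -
    have "Min {z, w} = z" "Max {z, w} = w" using that(2) by simp_all
    then have "\<epsilon> z = Star" "\<epsilon> w \<noteq> Star" using \<pi>(2) that(1) unfolding admissible_def by metis+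
    with that show ?thesis by (cases "\<epsilon> w") (auto simp: colour_def)
  qed
  moreover have "colour \<epsilon> \<pi> \<in> \<pi> \<rightarrow>\<^sub>E {1, -1}" by (auto simp: colour_def)
  ultimately show "x \<in> pair_partitions_B_label \<epsilon> n"
    using \<pi>(1) unfolding x pair_partitions_B_label_def pair_partitions_B_def by blast
qed

lemma prod_split_sign:
  fixes s :: "'b \<Rightarrow> int" and g :: "'b \<Rightarrow> 'c::comm_monoid_mult"
  assumes "finite A" "\<And>x. x \<in> A \<Longrightarrow> s x = 1 \<or> s x = -1"
  shows "prod g A = prod g {x \<in> A. s x = 1} * prod g {x \<in> A. s x = -1}"
proof -
  have "A = {x \<in> A. s x = 1} \<union> {x \<in> A. s x = -1}" using assms(2) by blast
  moreover have "{x \<in> A. s x = 1} \<inter> {x \<in> A. s x = -1} = {}" by auto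
  ultimately show ?thesis using assms(1) by (metis (no_types, lifting) finite_Un prod.union_disjoint)
qed

text \<open>All left legs carry \<open>Star\<close>, and the label of a right leg is read off the
  colour of its block. That block is the first one, \<open>V\<close>, in a crossing and the inner
  one, \<open>W\<close>, in a nesting, whence the splits by \<open>fst\<close> and
  \<open>snd\<close>.\<close>

lemma Xi_colour:
  assumes \<pi>: "\<pi> \<in> pair_partitions n" and kernel: "index_kernel n i = \<pi>" and adm: "admissible \<epsilon> \<pi>"
  shows "Xi Q (\<pi>, colour \<epsilon> \<pi>) i =
    (\<Prod>(p, q)\<in>{(p, q). 1 \<le> p \<and> p < q \<and> q \<le> n \<and> Max (block_of n i q) < Max (block_of n i p)}.
      Q (\<epsilon> p) (\<epsilon> q) (i p) (i q))"
proof -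
  let ?f = "colour \<epsilon> \<pi>"
  define C where "C = {(V, W) \<in> \<pi> \<times> \<pi>. crosses V W}"
  define N where "N = {(V, W) \<in> \<pi> \<times> \<pi>. nests V W}"
  have fin: "finite C" "finite N"
    unfolding C_def N_def
    using pair_partitionsD(2)[OF \<pi>] by (auto intro: finite_subset[of _ "\<pi> \<times> \<pi>"])
  have label: "\<epsilon> (Min V) = Star" "?f V = 1 \<Longrightarrow> \<epsilon> (Max V) = Plain" "?f V = -1 \<Longrightarrow> \<epsilon> (Max V) = Prime"
    "?f V = 1 \<or> ?f V = -1" if "V \<in> \<pi>" for V
    using adm that by (cases "\<epsilon> (Max V)"; auto simp: admissible_def colour_def)+
  have "(\<Prod>(p, q)\<in>{(p, q). 1 \<le> p \<and> p < q \<and> q \<le> n \<and> Max (block_of n i q) < Max (block_of n i p)}.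
      Q (\<epsilon> p) (\<epsilon> q) (i p) (i q)) =
    (\<Prod>(V, W)\<in>C. Q (\<epsilon> (Min W)) (\<epsilon> (Max V)) (i (Min W)) (i (Max V))) *
    (\<Prod>(V, W)\<in>N. Q (\<epsilon> (Min V)) (\<epsilon> (Min W)) (i (Min V)) (i (Min W)) *
      Q (\<epsilon> (Min V)) (\<epsilon> (Max W)) (i (Min V)) (i (Max W)))"
    unfolding prod_pair_partition_inversions[OF \<pi> kernel] C_def N_def ..
  also have "\<dots> =
    (\<Prod>(V, W)\<in>{x \<in> C. ?f (fst x) = 1}. Q Star Plain (i (Min W)) (i (Max V))) *
    (\<Prod>(V, W)\<in>{x \<in> C. ?f (fst x) = -1}. Q Star Prime (i (Min W)) (i (Max V))) *
    ((\<Prod>(V, W)\<in>{x \<in> N. ?f (snd x) = 1}.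
        Q Star Star (i (Min V)) (i (Min W)) * Q Star Plain (i (Min V)) (i (Max W))) *
    (\<Prod>(V, W)\<in>{x \<in> N. ?f (snd x) = -1}.
        Q Star Star (i (Min V)) (i (Min W)) * Q Star Prime (i (Min V)) (i (Max W))))"
    by (subst prod_split_sign[of C "?f \<circ> fst"], use fin label in \<open>force simp: C_def\<close>,
        use fin label in \<open>force simp: C_def\<close>,
        subst prod_split_sign[of N "?f \<circ> snd"], use fin label in \<open>force simp: N_def\<close>,
        use fin label in \<open>force simp: N_def\<close>,
        intro arg_cong2[where f = "(*)"] prod.cong)
      (auto simp: C_def N_def label)
  finally show ?thesis
    unfolding Xi_def C_def N_def by (simp add: case_prod_unfold mult.assoc conj_assoc)
qed

section \<open>Moments of words whose kernel is a pairing\<close>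

context clt_family
begin

lemma functional_word_pairing:
  assumes \<pi>: "\<pi> \<in> pair_partitions n" and kernel: "index_kernel n i = \<pi>"
    and pos: "i \<in> {1..n} \<rightarrow> {1..}"
  shows "\<phi> (word T i \<epsilon> 1 n) =
    (if admissible \<epsilon> \<pi>
     then complex_of_real (Xi Q (\<pi>, colour \<epsilon> \<pi>) i) *
        (\<Prod>V\<in>{V \<in> \<pi>. colour \<epsilon> \<pi> V = 1}. \<phi> (T Star (i (Min V)) * T Plain (i (Max V)))) *
        (\<Prod>V\<in>{V \<in> \<pi>. colour \<epsilon> \<pi> V = -1}. \<phi> (T Star (i (Min V)) * T Prime (i (Max V))))
     else 0)"
proof -
  let ?g = "\<lambda>V. \<phi> (T (\<epsilon> (Min V)) (i (Min V)) * T (\<epsilon> (Max V)) (i (Max V)))"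
  have "sorted_list_of_set V = [Min V, Max V]" if "V \<in> \<pi>" for V
    using sorted_list_of_pair pair_partitionsD(4,5)[OF \<pi> that] by metis
  then have "(\<Prod>V\<in>\<pi>. \<phi> (\<Prod>p\<leftarrow>sorted_list_of_set V. T (\<epsilon> p) (i p))) = prod ?g \<pi>"
    by (intro prod.cong) auto
  with functional_word[OF pos, of \<epsilon>] have word: "\<phi> (word T i \<epsilon> 1 n) =
    complex_of_real (\<Prod>(p, q)\<in>{(p, q). 1 \<le> p \<and> p < q \<and> q \<le> n \<and> Max (block_of n i q) < Max (block_of n i p)}.
      Q (\<epsilon> p) (\<epsilon> q) (i p) (i q)) * prod ?g \<pi>"
    unfolding kernel by simp
  show ?thesis
  proof (cases "admissible \<epsilon> \<pi>")
    case True
    have "prod ?g \<pi> = prod ?g {V \<in> \<pi>. colour \<epsilon> \<pi> V = 1} * prod ?g {V \<in> \<pi>. colour \<epsilon> \<pi> V = -1}"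
      using pair_partitionsD(2)[OF \<pi>] by (intro prod_split_sign) (auto simp: colour_def)
    also have "prod ?g {V \<in> \<pi>. colour \<epsilon> \<pi> V = 1} =
        (\<Prod>V\<in>{V \<in> \<pi>. colour \<epsilon> \<pi> V = 1}. \<phi> (T Star (i (Min V)) * T Plain (i (Max V))))"
      using True by (intro prod.cong) (auto simp: admissible_def colour_def split: if_splits)
    also have "prod ?g {V \<in> \<pi>. colour \<epsilon> \<pi> V = -1} =
        (\<Prod>V\<in>{V \<in> \<pi>. colour \<epsilon> \<pi> V = -1}. \<phi> (T Star (i (Min V)) * T Prime (i (Max V))))"
    proof (intro prod.cong refl)
      fix V assume "V \<in> {V \<in> \<pi>. colour \<epsilon> \<pi> V = -1}"
      with True show "?g V = \<phi> (T Star (i (Min V)) * T Prime (i (Max V)))"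
        by (cases "\<epsilon> (Max V)") (auto simp: admissible_def colour_def)
    qed
    finally have "prod ?g \<pi> =
        (\<Prod>V\<in>{V \<in> \<pi>. colour \<epsilon> \<pi> V = 1}. \<phi> (T Star (i (Min V)) * T Plain (i (Max V)))) *
        (\<Prod>V\<in>{V \<in> \<pi>. colour \<epsilon> \<pi> V = -1}. \<phi> (T Star (i (Min V)) * T Prime (i (Max V))))" .
    then show ?thesis
      unfolding word Xi_colour[OF \<pi> kernel True] using True by (simp only: if_True mult.assoc)
  next
    case False
    then obtain V where V: "V \<in> \<pi>" "\<not> (\<epsilon> (Min V) = Star \<and> \<epsilon> (Max V) \<noteq> Star)"
      by (auto simp: admissible_def)
    have "Min V \<in> V" "Max V \<in> V" using pair_partitionsD(4)[OF \<pi> V(1)] by blast+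
    moreover have "V \<in> index_kernel n i" using V(1) kernel by simp
    \<comment> \<open>Both legs carry the same index, so the moment of the offending block is one of
      the vanishing second moments and annihilates the product.\<close>
    ultimately have "i (Min V) = i (Max V)" "i (Max V) \<ge> 1"
      using pos by (auto simp: index_kernel_eq block_of_def)
    with V have "?g V = 0" by (simp add: second_moments)
    then have "prod ?g \<pi> = 0" using V(1) pair_partitionsD(2)[OF \<pi>] by (meson prod_zero)
    with False show ?thesis unfolding word by simp
  qed
qed

end

subsection \<open>Expansion of the moments of normalized sums\<close>

text \<open>Distributivity for noncommuting factors: the order of the factors is kept, and the
  induction appends the last one.\<close>

lemma prod_list_sum_PiE:
  fixes X :: "nat \<Rightarrow> nat \<Rightarrow> 'a::semiring_1"
  assumes "finite A"
  shows "(\<Prod>j\<leftarrow>[1..<Suc r]. \<Sum>v\<in>A. X j v) = (\<Sum>i\<in>{1..r} \<rightarrow>\<^sub>E A. \<Prod>j\<leftarrow>[1..<Suc r]. X j (i j))"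
proof (induction r)
  case 0
  then show ?case by simp
next
  case (Suc r)
  \<comment> \<open>Extensional tuples of length \<open>Suc r\<close> correspond bijectively to a
    last value together with a tuple of length \<open>r\<close>.\<close>
  let ?upd = "\<lambda>(v, i). i(Suc r := v)"
  let ?P = "\<lambda>i. \<Prod>j\<leftarrow>[1..<Suc r]. X j (i j)"
  have snoc: "[1..<Suc (Suc r)] = [1..<Suc r] @ [Suc r]" by simp
  have upd: "?P (i(Suc r := v)) = ?P i" for i v
    by (rule arg_cong[where f = prod_list]) (auto simp del: upt_Suc)
  have "(\<Prod>j\<leftarrow>[1..<Suc (Suc r)]. \<Sum>v\<in>A. X j v) =
      (\<Sum>i\<in>{1..r} \<rightarrow>\<^sub>E A. ?P i) * (\<Sum>v\<in>A. X (Suc r) v)"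
    unfolding snoc using Suc.IH by (simp del: upt_Suc)
  also have "\<dots> = (\<Sum>v\<in>A. \<Sum>i\<in>{1..r} \<rightarrow>\<^sub>E A. ?P i * X (Suc r) v)"
    by (simp only: sum_product sum.swap[of _ A])
  also have "\<dots> = (\<Sum>(v, i)\<in>A \<times> ({1..r} \<rightarrow>\<^sub>E A). ?P i * X (Suc r) v)"
    by (rule sum.cartesian_product)
  also have "\<dots> = (\<Sum>i\<in>?upd ` (A \<times> ({1..r} \<rightarrow>\<^sub>E A)). ?P i * X (Suc r) (i (Suc r)))"
    using inj_combinator[of "Suc r" "{1..r}" "\<lambda>_. A"]
    by (subst sum.reindex) (auto intro!: sum.cong simp: upd fun_upd_same simp del: upt_Suc fun_upd_apply One_nat_def)
  also have "?upd ` (A \<times> ({1..r} \<rightarrow>\<^sub>E A)) = {1..Suc r} \<rightarrow>\<^sub>E A"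
    by (simp only: atLeastAtMostSuc_conv[of 1 r] PiE_insert_eq)
  finally show ?case unfolding snoc by (simp del: upt_Suc)
qed

lemma (in star_algebra) prod_list_scale:
  "(\<Prod>j\<leftarrow>js. scaleC c (Y j)) = scaleC (c ^ length js) (\<Prod>j\<leftarrow>js. Y j)"
  by (induction js) (simp_all add: scale_mult_left scale_mult_right)

text \<open>A tuple with kernel \<open>\<pi>\<close> is constant on blocks, hence determined by its
  values at the block minima; this embeds the tuples into the functions from \<open>\<pi>\<close> to
  \<open>{1..N}\<close>.\<close>

lemma card_indices_le:
  assumes "partition_on {1..n} \<pi>"
  shows "card {i \<in> {1..n} \<rightarrow>\<^sub>E {1..N}. index_kernel n i = \<pi>} \<le> N ^ card \<pi>"
proof -
  let ?S = "{i \<in> {1..n} \<rightarrow>\<^sub>E {1..N}. index_kernel n i = \<pi>}"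
  let ?F = "\<lambda>i. \<lambda>V\<in>\<pi>. i (Min V)"
  have fin: "finite \<pi>" using assms by (rule finite_elements[rotated]) simp
  have Min: "Min V \<in> V" if "V \<in> \<pi>" for V
    using partition_on_finite_block[OF assms that] by (intro Min_in)
  have inj: "inj_on ?F ?S"
  proof (rule inj_onI)
    fix i i' assume i: "i \<in> ?S" and i': "i' \<in> ?S" and eq: "?F i = ?F i'"
    have "i p = i' p" if p: "p \<in> {1..n}" for p
    proof -
      from p assms obtain V where V: "V \<in> \<pi>" "p \<in> V" unfolding partition_on_def by blast
      have const: "h (Min V) = h p" if "h \<in> ?S" for h
      proof -
        have "V = block_of n h p"
          using that V by (intro mem_index_kernel_imp_block_of) auto
        with Min[OF V(1)] have "Min V \<in> block_of n h p" by metis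
        then show ?thesis by (simp add: block_of_def)
      qed
      from fun_cong[OF eq, of V] V(1) const[OF i] const[OF i'] show ?thesis by simp
    qed
    with i i' show "i = i'" by (auto intro: PiE_ext)
  qed
  have "?F ` ?S \<subseteq> \<pi> \<rightarrow>\<^sub>E {1..N}"
  proof (rule image_subsetI)
    fix i assume i: "i \<in> ?S"
    have "i (Min V) \<in> {1..N}" if "V \<in> \<pi>" for V
      using i Min[OF that] partition_on_finite_block(2)[OF assms that] by blast
    then show "?F i \<in> \<pi> \<rightarrow>\<^sub>E {1..N}" by simp
  qed
  then have "card ?S \<le> card (\<pi> \<rightarrow>\<^sub>E {1..N})"
    using inj fin by (intro card_inj_on_le finite_PiE) auto
  also have "\<dots> = N ^ card \<pi>" using fin by (simp add: card_PiE)
  finally show ?thesis .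
qed

lemma sum_card_partition:
  assumes "partition_on {1..n::nat} \<pi>"
  shows "(\<Sum>V\<in>\<pi>. card V) = n"
proof -
  have "card (\<Union>\<pi>) = (\<Sum>V\<in>\<pi>. card V)"
    using assms partition_on_finite_block(1)[OF assms]
    by (intro card_Union_disjoint) (auto simp: partition_on_def disjoint_def pairwise_def disjnt_def)
  then show ?thesis using assms by (simp add: partition_on_def)
qed

text \<open>Every block has at least two elements and, outside the pairings, some block has more;
  adding up block sizes gives the strict inequality.\<close>

lemma card_partition_less:
  assumes \<pi>: "partition_on {1..n::nat} \<pi>" and "\<forall>V\<in>\<pi>. card V \<noteq> 1" and "\<pi> \<notin> pair_partitions n"
  shows "2 * card \<pi> < n"
proof -
  have fin: "finite \<pi>" using \<pi> by (rule finite_elements[rotated]) simp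
  have ge: "2 \<le> card V" if "V \<in> \<pi>" for V
  proof -
    have "card V \<noteq> 0" using partition_on_finite_block[OF \<pi> that] by simp
    with assms(2) that show ?thesis by (metis One_nat_def less_2_cases not_le)
  qed
  moreover from assms obtain V where "V \<in> \<pi>" "card V \<noteq> 2" by (auto simp: pair_partitions_def)
  ultimately have "(\<Sum>V\<in>\<pi>. 2) < (\<Sum>V\<in>\<pi>. card V)"
    using fin by (intro sum_strict_mono_ex1) (auto simp: le_less)
  then show ?thesis by (simp add: sum_card_partition[OF \<pi>] mult.commute)
qed

lemma even_if_pair_partition:
  assumes "\<pi> \<in> pair_partitions n"
  shows "even n"
proof -
  have "(\<Sum>V\<in>\<pi>. card V) = n"
    using sum_card_partition pair_partitionsD(1)[OF assms] .
  moreover have "(\<Sum>V\<in>\<pi>. card V) = (\<Sum>V\<in>\<pi>. 2)"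
    using pair_partitionsD(3)[OF assms] by (intro sum.cong) auto
  ultimately show ?thesis by (metis dvd_triv_right sum_constant)
qed

section \<open>Asymptotics of the contribution of each kernel\<close>

context clt_family
begin

definition partition_term :: "nat \<Rightarrow> (nat \<Rightarrow> label) \<Rightarrow> nat set set \<Rightarrow> nat \<Rightarrow> complex"
  where "partition_term r \<epsilon> \<pi> N = complex_of_real ((1 / sqrt (real N)) ^ r) *
    (\<Sum>i\<in>{i \<in> {1..r} \<rightarrow>\<^sub>E {1..N}. index_kernel r i = \<pi>}. \<phi> (word T i \<epsilon> 1 r))"

lemma moment_normalized_sum:
  "\<phi> (\<Prod>j\<leftarrow>[1..<Suc r]. normalized_sum scaleC T N (\<epsilon> j)) =
    (\<Sum>\<pi>\<in>{\<pi>. partition_on {1..r} \<pi>}. partition_term r \<epsilon> \<pi> N)"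
proof -
  let ?c = "complex_of_real (1 / sqrt (real N))"
  have fin: "finite ({1..r} \<rightarrow>\<^sub>E {1..N})" by (intro finite_PiE) auto
  have finP: "finite {\<pi>. partition_on {1..r} \<pi>}"
    by (rule finitely_many_partition_on) simp
  have "(\<Prod>j\<leftarrow>[1..<Suc r]. normalized_sum scaleC T N (\<epsilon> j)) =
      scaleC (?c ^ r) (\<Sum>i\<in>{1..r} \<rightarrow>\<^sub>E {1..N}. word T i \<epsilon> 1 r)"
    unfolding normalized_sum_def prod_list_scale word_def
    by (subst prod_list_sum_PiE) (simp_all del: upt_Suc)
  then have "\<phi> (\<Prod>j\<leftarrow>[1..<Suc r]. normalized_sum scaleC T N (\<epsilon> j)) =
      ?c ^ r * (\<Sum>i\<in>{1..r} \<rightarrow>\<^sub>E {1..N}. \<phi> (word T i \<epsilon> 1 r))"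
    by (simp only: functional.scale functional.sum)
  \<comment> \<open>Every tuple has exactly one kernel, a partition of \<open>{1..r}\<close>, so the
    fibres of \<open>index_kernel r\<close> split the sum.\<close>
  also have "(\<Sum>i\<in>{1..r} \<rightarrow>\<^sub>E {1..N}. \<phi> (word T i \<epsilon> 1 r)) =
      (\<Sum>\<pi>\<in>{\<pi>. partition_on {1..r} \<pi>}.
        \<Sum>i\<in>{i \<in> {1..r} \<rightarrow>\<^sub>E {1..N}. index_kernel r i = \<pi>}. \<phi> (word T i \<epsilon> 1 r))"
    using partition_on_index_kernel by (intro sum.group[OF fin finP, symmetric]) blast
  finally show ?thesis
    by (simp add: partition_term_def sum_distrib_left)
qed

lemma partition_term_tendsto_0:
  assumes \<pi>: "partition_on {1..r} \<pi>" and "\<pi> \<notin> pair_partitions r"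
  shows "partition_term r \<epsilon> \<pi> \<longlonglongrightarrow> 0"
proof (cases "\<exists>V\<in>\<pi>. card V = 1")
  case True
  then obtain V where V: "V \<in> \<pi>" "card V = 1" by blast
  have "\<phi> (word T i \<epsilon> 1 r) = 0"
    if "i \<in> {i \<in> {1..r} \<rightarrow>\<^sub>E {1..N}. index_kernel r i = \<pi>}" for i N
    using that V by (intro functional_word_singleton[of i r V]) auto
  then have "partition_term r \<epsilon> \<pi> = (\<lambda>N. 0)"
    by (auto simp: partition_term_def intro!: ext sum.neutral)
  then show ?thesis by simp
next
  case False
  then have "2 * card \<pi> < r" using card_partition_less[OF \<pi> _ assms(2)] by blast
  \<comment> \<open>\<open>Suc d\<close> is the positive surplus of normalizing factors over those
    needed to balance the number of tuples.\<close>
  then obtain d where r: "r = Suc d + 2 * card \<pi>" by (metis add.commute add_Suc_right less_imp_Suc_add)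
  from bounds[OF \<pi>] obtain \<rho> where \<rho>: "\<rho> \<ge> 0"
    "\<And>i. i \<in> {1..r} \<rightarrow> {1..} \<Longrightarrow> index_kernel r i = \<pi> \<Longrightarrow> cmod (\<phi> (word T i \<epsilon> 1 r)) \<le> \<rho>" by blast
  have "cmod (partition_term r \<epsilon> \<pi> N) \<le> \<rho> * sqrt (1 / real N)" if "N \<ge> 1" for N
  proof -
    let ?S = "{i \<in> {1..r} \<rightarrow>\<^sub>E {1..N}. index_kernel r i = \<pi>}"
    define s where "s = 1 / sqrt (real N)"
    have s: "0 \<le> s" "s \<le> 1" "s\<^sup>2 * real N = 1"
      using that by (auto simp: s_def power_divide)
    have "cmod (\<Sum>i\<in>?S. \<phi> (word T i \<epsilon> 1 r)) \<le> of_nat (card ?S) * \<rho>"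
      by (rule sum_norm_bound, rule \<rho>(2)) auto
    also have "\<dots> \<le> real (N ^ card \<pi>) * \<rho>"
      using card_indices_le[OF \<pi>, of N] \<rho>(1) by (intro mult_right_mono) (simp_all only: of_nat_le_iff)
    finally have "cmod (partition_term r \<epsilon> \<pi> N) \<le> s ^ r * (real N ^ card \<pi> * \<rho>)"
      unfolding partition_term_def norm_mult s_def[symmetric]
      using s(1) by (simp add: mult_left_mono norm_power)
    \<comment> \<open>Each of the \<open>card \<pi>\<close> factors \<open>N\<close> absorbs two
      factors \<open>s\<close>; at least one \<open>s\<close> is left, which gives the rate
      N^(-1/2).\<close>
    also have "\<dots> = s ^ Suc d * (s\<^sup>2 * real N) ^ card \<pi> * \<rho>"
      by (simp only: r power_add power_mult power_mult_distrib mult.assoc)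
    also have "\<dots> = s ^ Suc d * \<rho>" using s(3) by simp
    also have "\<dots> \<le> s * \<rho>"
      using power_decreasing[of 1 "Suc d" s] s \<rho>(1) by (intro mult_right_mono) auto
    finally show ?thesis by (simp add: s_def real_sqrt_divide mult.commute)
  qed
  then have "eventually (\<lambda>N. norm (partition_term r \<epsilon> \<pi> N) \<le> \<rho> * sqrt (1 / real N)) sequentially"
    by (auto simp: eventually_sequentially)
  moreover have "(\<lambda>N. \<rho> * sqrt (1 / real N)) \<longlonglongrightarrow> 0"
    using tendsto_mult_left[OF tendsto_real_sqrt[OF lim_1_over_n], of \<rho>] by simp
  ultimately show ?thesis by (rule Lim_null_comparison)
qed

lemma partition_term_pairing:
  assumes \<pi>: "\<pi> \<in> pair_partitions (2 * n)"
  shows "partition_term (2 * n) \<epsilon> \<pi> N =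
    (if admissible \<epsilon> \<pi> then lambda_seq \<phi> T Q n (\<pi>, colour \<epsilon> \<pi>) N else 0)"
proof -
  let ?S = "{i \<in> {1..2 * n} \<rightarrow>\<^sub>E {1..N}. index_kernel (2 * n) i = \<pi>}"
  \<comment> \<open>Both sides agree for \<open>N = 0\<close> as well, division by zero being zero,
    so the identity needs no lower bound on \<open>N\<close>.\<close>
  have "complex_of_real ((1 / sqrt (real N)) ^ (2 * n)) = 1 / of_nat N ^ n"
    by (simp add: power_mult power_divide)
  moreover have "i \<in> {1..2 * n} \<rightarrow> {1..}" if "i \<in> ?S" for i
    using that by auto
  then have "(\<Sum>i\<in>?S. \<phi> (word T i \<epsilon> 1 (2 * n))) = (\<Sum>i\<in>?S. if admissible \<epsilon> \<pi>
     then complex_of_real (Xi Q (\<pi>, colour \<epsilon> \<pi>) i) *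
        (\<Prod>V\<in>{V \<in> \<pi>. colour \<epsilon> \<pi> V = 1}. \<phi> (T Star (i (Min V)) * T Plain (i (Max V)))) *
        (\<Prod>V\<in>{V \<in> \<pi>. colour \<epsilon> \<pi> V = -1}. \<phi> (T Star (i (Min V)) * T Prime (i (Max V))))
     else 0)"
    by (intro sum.cong refl functional_word_pairing[OF \<pi>]) auto
  ultimately show ?thesis
    unfolding partition_term_def lambda_seq_def by simp
qed

text \<open>The set of partitions of \<open>{1..r}\<close> is finite and independent of
  \<open>N\<close>, so the limit may be taken kernel by kernel.\<close>

lemma moment_normalized_sum_tendsto:
  assumes limits: "\<And>n \<epsilon> \<pi>f. \<pi>f \<in> pair_partitions_B_label \<epsilon> (2 * n) \<Longrightarrow>
    convergent (lambda_seq \<phi> T Q n \<pi>f)"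
  shows "(\<lambda>N. \<phi> (\<Prod>j\<leftarrow>[1..<Suc r]. normalized_sum scaleC T N (\<epsilon> j)))
    \<longlonglongrightarrow> (\<Sum>\<pi>f\<in>pair_partitions_B_label \<epsilon> r. lambda_lim \<phi> T Q (r div 2) \<pi>f)"
proof -
  let ?P = "{\<pi>. partition_on {1..r} \<pi>}"
  define A where "A = {\<pi> \<in> pair_partitions r. admissible \<epsilon> \<pi>}"
  \<comment> \<open>The default 0 covers kernels that are no pairings, whose terms vanish
    asymptotically, and inadmissible pairings, whose terms are identically zero.\<close>
  define L where "L \<pi> = (if \<pi> \<in> A then lambda_lim \<phi> T Q (r div 2) (\<pi>, colour \<epsilon> \<pi>) else 0)" for \<pi>
  have finP: "finite ?P" by (rule finitely_many_partition_on) simp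
  have "partition_term r \<epsilon> \<pi> \<longlonglongrightarrow> L \<pi>" if "\<pi> \<in> ?P" for \<pi>
  proof (cases "\<pi> \<in> pair_partitions r")
    case False
    then show ?thesis using partition_term_tendsto_0[of r \<pi> \<epsilon>] that by (simp add: L_def A_def)
  next
    case True
    obtain n where r: "r = 2 * n" using even_if_pair_partition[OF True] by (elim evenE)
    have pairing: "partition_term r \<epsilon> \<pi> =
        (\<lambda>N. if admissible \<epsilon> \<pi> then lambda_seq \<phi> T Q n (\<pi>, colour \<epsilon> \<pi>) N else 0)"
      using partition_term_pairing True unfolding r by blast
    show ?thesis
    proof (cases "admissible \<epsilon> \<pi>")
      case adm: True
      then have "(\<pi>, colour \<epsilon> \<pi>) \<in> pair_partitions_B_label \<epsilon> (2 * n)"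
        using True by (auto simp: pair_partitions_B_label_eq r)
      then have "lambda_seq \<phi> T Q n (\<pi>, colour \<epsilon> \<pi>) \<longlonglongrightarrow> lambda_lim \<phi> T Q n (\<pi>, colour \<epsilon> \<pi>)"
        unfolding lambda_lim_def using limits by (simp add: convergent_LIMSEQ_iff)
      then show ?thesis unfolding pairing using adm True by (simp add: L_def A_def r)
    qed (simp add: pairing L_def A_def)
  qed
  then have "(\<lambda>N. \<Sum>\<pi>\<in>?P. partition_term r \<epsilon> \<pi> N) \<longlonglongrightarrow> (\<Sum>\<pi>\<in>?P. L \<pi>)"
    by (intro tendsto_sum) auto
  also have "(\<Sum>\<pi>\<in>?P. L \<pi>) = (\<Sum>\<pi>\<in>A. L \<pi>)"
    using finP pair_partitionsD(1) by (intro sum.mono_neutral_right) (auto simp: A_def L_def)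
  \<comment> \<open>Attaching the forced colouring to a pairing is injective, so nothing is merged
    when passing to coloured pairings.\<close>
  also have "\<dots> = (\<Sum>\<pi>f\<in>pair_partitions_B_label \<epsilon> r. lambda_lim \<phi> T Q (r div 2) \<pi>f)"
    unfolding pair_partitions_B_label_eq A_def[symmetric]
    by (subst sum.reindex) (auto simp: L_def inj_on_def)
  finally show ?thesis unfolding moment_normalized_sum .
qed

end

theorem theorem1:
  fixes scaleC :: "complex \<Rightarrow> 'a::ring_1 \<Rightarrow> 'a"
    and star :: "'a \<Rightarrow> 'a"
    and \<phi> :: "'a \<Rightarrow> complex"
    and T :: "label \<Rightarrow> nat \<Rightarrow> 'a"
    and Q :: "label \<Rightarrow> label \<Rightarrow> nat \<Rightarrow> nat \<Rightarrow> real"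
  assumes "noncomm_prob_space scaleC star \<phi>"
    and adjoint: "\<forall>i\<ge>1. T Star i = star (T Plain i)"
    and means: "\<forall>i\<ge>1. \<forall>e. \<phi> (T e i) = 0"
    and second_moments: "\<forall>i\<ge>1.
        \<phi> (T Star i * T Star i) = 0 \<and>
        \<phi> (T Plain i * T Plain i) = 0 \<and>
        \<phi> (T Plain i * T Star i) = 0 \<and>
        \<phi> (T Plain i * T Prime i) = 0 \<and>
        \<phi> (T Prime i * T Prime i) = 0 \<and>
        \<phi> (T Prime i * T Plain i) = 0 \<and>
        \<phi> (T Prime i * T Star i) = 0"
    and bounds: "\<forall>n \<pi>. partition_on {1..n} \<pi> \<longrightarrow>
        (\<exists>\<rho>\<ge>0::real. \<forall>i \<in> {1..n} \<rightarrow> {1..}. \<forall>\<epsilon>.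
           index_kernel n i = \<pi> \<longrightarrow> cmod (\<phi> (word T i \<epsilon> 1 n)) \<le> \<rho>)"
    and factorization: "\<forall>m (k :: nat \<Rightarrow> nat). \<forall>i \<in> {1..k m} \<rightarrow> {1..}. \<forall>\<epsilon>.
        k 0 = 0 \<and> (\<forall>j<m. k j < k (Suc j)) \<and>
        index_kernel (k m) i = (\<lambda>j. {k j + 1..k (Suc j)}) ` {..<m} \<longrightarrow>
        \<phi> (word T i \<epsilon> 1 (k m)) = (\<Prod>j<m. \<phi> (word T i \<epsilon> (k j + 1) (k (Suc j))))"
    and commutation: "\<forall>i\<ge>1. \<forall>j\<ge>1. \<forall>e e'. i \<noteq> j \<longrightarrow>
        T e i * T e' j = scaleC (complex_of_real (Q e e' i j)) (T e' j * T e i)"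
    and limits: "\<forall>n \<epsilon>. \<forall>\<pi>f \<in> pair_partitions_B_label \<epsilon> (2 * n).
        convergent (lambda_seq \<phi> T Q n \<pi>f)"
  shows "\<forall>r \<epsilon>.
    (even r \<longrightarrow>
      (\<lambda>N. \<phi> (\<Prod>j\<leftarrow>[1..<Suc r]. normalized_sum scaleC T N (\<epsilon> j)))
        \<longlonglongrightarrow> (\<Sum>\<pi>f \<in> pair_partitions_B_label \<epsilon> r. lambda_lim \<phi> T Q (r div 2) \<pi>f)) \<and>
    (odd r \<longrightarrow>
      (\<lambda>N. \<phi> (\<Prod>j\<leftarrow>[1..<Suc r]. normalized_sum scaleC T N (\<epsilon> j))) \<longlonglongrightarrow> 0)"
proof -
  interpret noncomm_prob_space scaleC star \<phi> by fact
  interpret clt_family scaleC star \<phi> T Q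
  proof unfold_locales
    show "\<phi> (T e i) = 0" if "i \<ge> 1" for e i
      using means that by blast
    show "\<phi> (T e i * T e' i) = 0" if "i \<ge> 1" "\<not> (e = Star \<and> e' \<noteq> Star)" for e e' i
      using second_moments that by (cases e; cases e') auto
    show "\<exists>\<rho>\<ge>0::real. \<forall>i \<in> {1..n} \<rightarrow> {1..}. \<forall>\<epsilon>.
        index_kernel n i = \<pi> \<longrightarrow> cmod (\<phi> (word T i \<epsilon> 1 n)) \<le> \<rho>"
      if "partition_on {1..n} \<pi>" for n \<pi>
      using bounds that by blast
    show "\<phi> (word T h \<epsilon> 1 (k m)) = (\<Prod>j<m. \<phi> (word T h \<epsilon> (k j + 1) (k (Suc j))))"
      if "h \<in> {1..k m} \<rightarrow> {1..}" "k 0 = 0" "\<And>j. j < m \<Longrightarrow> k j < k (Suc j)"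
        "index_kernel (k m) h = (\<lambda>j. {k j + 1..k (Suc j)}) ` {..<m}" for h k m \<epsilon>
      using factorization that by blast
    show "T e i * T e' j = scaleC (complex_of_real (Q e e' i j)) (T e' j * T e i)"
      if "i \<ge> 1" "j \<ge> 1" "i \<noteq> j" for e e' i j
      using commutation that by blast
  qed
  have tendsto: "(\<lambda>N. \<phi> (\<Prod>j\<leftarrow>[1..<Suc r]. normalized_sum scaleC T N (\<epsilon> j)))
      \<longlonglongrightarrow> (\<Sum>\<pi>f\<in>pair_partitions_B_label \<epsilon> r. lambda_lim \<phi> T Q (r div 2) \<pi>f)" for r \<epsilon>
    using limits by (intro moment_normalized_sum_tendsto) blast
  \<comment> \<open>The convergence statement holds for either parity; for odd \<open>r\<close>
    there are no pairings and the limit is an empty sum.\<close>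
  have "pair_partitions_B_label \<epsilon> r = {}" if "odd r" for r \<epsilon>
    using that even_if_pair_partition by (auto simp: pair_partitions_B_label_eq)
  then have "(\<Sum>\<pi>f\<in>pair_partitions_B_label \<epsilon> r. lambda_lim \<phi> T Q (r div 2) \<pi>f) = 0" if "odd r" for r \<epsilon>
    using that by simp
  with tendsto show ?thesis by metis
qed

end
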